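(* Let $G$ be a graph that has a cartesian NAC-coloring. Then there exist graphs $Q_1,Q_2$, each with at least two vertices, and an injective graph morphism $h:G\to Q_1\mathbin{\square}Q_2$ such that each vertex of $V_{Q_1}\cup V_{Q_2}$ occurs as a coordinate of some vertex in $h(G)$. In particular, $G$ can be viewed as a subgraph of $Q_1\mathbin{\square}Q_2$.
   Context: A NAC-coloring of a graph $G$ is a surjective map $\delta:E_G\to\{\text{red},\text{blue}\}$ such that every cycle of $G$ is either monochromatic or contains at least two edges of each color. It is cartesian if no two distinct vertices of $G$ are connected by both a red path and a blue path. The cartesian product $G\mathbin{\square}H$ has vertex set $V_G\times V_H$, with $(u,u')(v,v')$ an edge iff ($u=v$ and $u'v'\in E_H$) or ($u'=v'$ and $uv\in E_G$). A graph morphism maps vertices to vertices and edges to edges. *)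

theory Defs
  imports Main
begin

text \<open>
  Simple undirected graphs (no loops, no parallel edges), finite or infinite.
  An edge is the set of its two endpoints.
\<close>

record 'a graph =
  verts :: "'a set"
  edges :: "'a set set"

definition simple_graph :: "'a graph \<Rightarrow> bool" where
  "simple_graph G \<longleftrightarrow>
     (\<forall>e \<in> edges G. \<exists>u \<in> verts G. \<exists>v \<in> verts G. u \<noteq> v \<and> e = {u, v})"

definition path_edges :: "'a list \<Rightarrow> 'a set set" where
  "path_edges p = {{p ! i, p ! Suc i} | i. Suc i < length p}"

definition is_path :: "'a graph \<Rightarrow> 'a list \<Rightarrow> bool" where
  "is_path G p \<longleftrightarrow>
     p \<noteq> [] \<and> distinct p \<and> set p \<subseteq> verts G \<and> path_edges p \<subseteq> edges G"

text \<open>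
  A cycle is given by the list of its pairwise distinct vertices in cyclic order;
  the first vertex is not repeated at the end.
\<close>

definition cycle_edges :: "'a list \<Rightarrow> 'a set set" where
  "cycle_edges c = {{c ! i, c ! (Suc i mod length c)} | i. i < length c}"

definition is_cycle :: "'a graph \<Rightarrow> 'a list \<Rightarrow> bool" where
  "is_cycle G c \<longleftrightarrow>
     length c \<ge> 3 \<and> distinct c \<and> set c \<subseteq> verts G \<and> cycle_edges c \<subseteq> edges G"

datatype color = Red | Blue

definition nac_coloring :: "'a graph \<Rightarrow> ('a set \<Rightarrow> color) \<Rightarrow> bool" where
  "nac_coloring G \<delta> \<longleftrightarrow>
     \<delta> ` edges G = UNIV \<and>
     (\<forall>c. is_cycle G c \<longrightarrow>
        (\<exists>k. \<forall>e \<in> cycle_edges c. \<delta> e = k) \<or>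
        (\<forall>k. card {e \<in> cycle_edges c. \<delta> e = k} \<ge> 2))"

definition mono_connected ::
    "'a graph \<Rightarrow> ('a set \<Rightarrow> color) \<Rightarrow> color \<Rightarrow> 'a \<Rightarrow> 'a \<Rightarrow> bool" where
  "mono_connected G \<delta> k u v \<longleftrightarrow>
     (\<exists>p. is_path G p \<and> hd p = u \<and> last p = v \<and> (\<forall>e \<in> path_edges p. \<delta> e = k))"

definition cartesian_nac_coloring :: "'a graph \<Rightarrow> ('a set \<Rightarrow> color) \<Rightarrow> bool" where
  "cartesian_nac_coloring G \<delta> \<longleftrightarrow>
     nac_coloring G \<delta> \<and>
     \<not> (\<exists>u \<in> verts G. \<exists>v \<in> verts G. u \<noteq> v \<and>
          mono_connected G \<delta> Red u v \<and> mono_connected G \<delta> Blue u v)"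

definition cartesian_product :: "'a graph \<Rightarrow> 'b graph \<Rightarrow> ('a \<times> 'b) graph"
    (infixr "\<box>" 80) where
  "G \<box> H =
     \<lparr>verts = verts G \<times> verts H,
      edges = {{(u, u'), (v, v')} | u u' v v'.
                 u \<in> verts G \<and> v \<in> verts G \<and> u' \<in> verts H \<and> v' \<in> verts H \<and>
                 (u = v \<and> {u', v'} \<in> edges H \<or> u' = v' \<and> {u, v} \<in> edges G)}\<rparr>"

definition graph_morphism :: "'a graph \<Rightarrow> 'b graph \<Rightarrow> ('a \<Rightarrow> 'b) \<Rightarrow> bool" where
  "graph_morphism G H h \<longleftrightarrow>
     h ` verts G \<subseteq> verts H \<and> (\<forall>e \<in> edges G. h ` e \<in> edges H)"

definition graph_isomorphism :: "'a graph \<Rightarrow> 'b graph \<Rightarrow> ('a \<Rightarrow> 'b) \<Rightarrow> bool" where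
  "graph_isomorphism G H h \<longleftrightarrow>
     bij_betw h (verts G) (verts H) \<and>
     (\<forall>u \<in> verts G. \<forall>v \<in> verts G. {u, v} \<in> edges G \<longleftrightarrow> {h u, h v} \<in> edges H)"

definition subgraph :: "'a graph \<Rightarrow> 'a graph \<Rightarrow> bool" where
  "subgraph S G \<longleftrightarrow>
     simple_graph S \<and> verts S \<subseteq> verts G \<and> edges S \<subseteq> edges G"

lemma simple_graph_cartesian_product:
  assumes "simple_graph G" "simple_graph H"
  shows "simple_graph (G \<box> H)"
proof -
  have "x \<noteq> y" if "{x, y} \<in> edges G" for x y
    using assms(1) that unfolding simple_graph_def by (metis doubleton_eq_iff)
  moreover have "x \<noteq> y" if "{x, y} \<in> edges H" for x y
    using assms(2) that unfolding simple_graph_def by (metis doubleton_eq_iff)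
  ultimately show ?thesis
    unfolding simple_graph_def cartesian_product_def by simp blast
qed

end

(*
  A vertex is sent to the pair of its red and its blue component, and the factors are the
  corresponding quotients of G.  Cartesianness says exactly that this map is injective.  The two
  ends of an edge agree in the component of the edge's own color, so by injectivity they differ
  in the other one; hence the quotients are loop-free and every edge of G becomes an edge of the
  product.
*)

theory Submission
  imports Defs
begin

definition mono_adj :: "'a graph \<Rightarrow> ('a set \<Rightarrow> color) \<Rightarrow> color \<Rightarrow> 'a \<Rightarrow> 'a \<Rightarrow> bool" where
  "mono_adj G \<delta> k u v \<longleftrightarrow> {u, v} \<in> edges G \<and> \<delta> {u, v} = k"

text \<open>Reachability is by walks, as a closure, so components can be compared without keeping
  vertices distinct; \<open>mono_connected_if_rtranclp\<close> leads back to the paths that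
  \<open>cartesian_nac_coloring\<close> speaks of.\<close>

definition mono_component :: "'a graph \<Rightarrow> ('a set \<Rightarrow> color) \<Rightarrow> color \<Rightarrow> 'a \<Rightarrow> 'a set" where
  "mono_component G \<delta> k v = {w. (mono_adj G \<delta> k)\<^sup>*\<^sup>* v w}"

text \<open>Edges of color \<open>k\<close> are discarded: for a cartesian coloring they would become loops.\<close>

definition mono_quotient :: "'a graph \<Rightarrow> ('a set \<Rightarrow> color) \<Rightarrow> color \<Rightarrow> 'a set graph" where
  "mono_quotient G \<delta> k =
     \<lparr>verts = mono_component G \<delta> k ` verts G,
      edges = {{mono_component G \<delta> k u, mono_component G \<delta> k v} | u v.
                 {u, v} \<in> edges G \<and> \<delta> {u, v} \<noteq> k}\<rparr>"

section \<open>Edges of simple graphs and of products\<close>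

lemma simple_graph_edgeD:
  assumes "simple_graph G" "{u, v} \<in> edges G"
  shows "u \<in> verts G" "v \<in> verts G" "u \<noteq> v"
  using assms unfolding simple_graph_def by (metis doubleton_eq_iff)+

lemma simple_graph_edgeE:
  assumes "simple_graph G" "e \<in> edges G"
  obtains u v where "u \<in> verts G" "v \<in> verts G" "u \<noteq> v" "e = {u, v}"
  using assms unfolding simple_graph_def by blast

lemma cartesian_product_edgeI:
  assumes "p \<in> verts G \<times> verts H" "q \<in> verts G \<times> verts H"
    and "fst p = fst q \<and> {snd p, snd q} \<in> edges H \<or> snd p = snd q \<and> {fst p, fst q} \<in> edges G"
  shows "{p, q} \<in> edges (G \<box> H)"
  using assms unfolding cartesian_product_def
  by (cases p; cases q) (simp, blast)

section \<open>From monochromatic walks to monochromatic paths\<close>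

lemma path_edges_append_subset: "path_edges p \<subseteq> path_edges (p @ q)"
proof
  fix e assume "e \<in> path_edges p"
  then obtain i where "Suc i < length p" "e = {p ! i, p ! Suc i}"
    unfolding path_edges_def by blast
  then have "Suc i < length (p @ q)" "e = {(p @ q) ! i, (p @ q) ! Suc i}"
    by (simp_all add: nth_append)
  then show "e \<in> path_edges (p @ q)" unfolding path_edges_def by blast
qed

lemma path_edges_snoc:
  assumes "p \<noteq> []"
  shows "path_edges (p @ [w]) = insert {last p, w} (path_edges p)"
proof
  show "path_edges (p @ [w]) \<subseteq> insert {last p, w} (path_edges p)"
  proof
    fix e assume "e \<in> path_edges (p @ [w])"
    then obtain i where i: "Suc i < length (p @ [w])" "e = {(p @ [w]) ! i, (p @ [w]) ! Suc i}"
      unfolding path_edges_def by blast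
    show "e \<in> insert {last p, w} (path_edges p)"
    proof (cases "Suc i < length p")
      case True
      then have "e = {p ! i, p ! Suc i}" using i by (simp add: nth_append)
      then show ?thesis using True unfolding path_edges_def by blast
    next
      case False
      then have "length p = Suc i" using i by simp
      then have "e = {last p, w}" using i assms by (simp add: nth_append last_conv_nth)
      then show ?thesis by simp
    qed
  qed
  \<comment> \<open>As \<open>p\<close> is nonempty, \<open>length p - 1\<close> is a genuine index,
    that of the last entry of \<open>p\<close>, and its successor is the position of
    \<open>w\<close>.\<close>
  have "{last p, w} = {(p @ [w]) ! (length p - 1), (p @ [w]) ! Suc (length p - 1)}"
    using assms by (simp add: nth_append last_conv_nth)
  moreover have "Suc (length p - 1) < length (p @ [w])" using assms by simp
  ultimately have "{last p, w} \<in> path_edges (p @ [w])" unfolding path_edges_def by blast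
  then show "insert {last p, w} (path_edges p) \<subseteq> path_edges (p @ [w])"
    using path_edges_append_subset by blast
qed

lemma mono_connected_refl:
  assumes "u \<in> verts G"
  shows "mono_connected G \<delta> k u u"
  unfolding mono_connected_def is_path_def
  by (rule exI[of _ "[u]"]) (use assms in \<open>simp add: path_edges_def\<close>)

text \<open>Appending \<open>w\<close> could repeat a vertex. If \<open>w\<close> already lies on
  the path, the prefix ending in \<open>w\<close> serves instead, its edges being among those of the
  old path; otherwise \<open>w\<close> is appended.\<close>

lemma mono_connected_step:
  assumes "simple_graph G" "mono_connected G \<delta> k u v" "mono_adj G \<delta> k v w"
  shows "mono_connected G \<delta> k u w"
proof -
  obtain p where p: "is_path G p" "hd p = u" "last p = v" "\<forall>e \<in> path_edges p. \<delta> e = k"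
    using assms(2) unfolding mono_connected_def by blast
  then have "p \<noteq> []" unfolding is_path_def by blast
  show ?thesis
  proof (cases "w \<in> set p")
    case True
    then obtain xs ys where "p = (xs @ [w]) @ ys" by (auto dest: split_list)
    moreover from this have "path_edges (xs @ [w]) \<subseteq> path_edges p"
      using path_edges_append_subset by metis
    moreover have "hd ((xs @ [w]) @ ys) = hd (xs @ [w])" by (cases xs) auto
    ultimately show ?thesis
      using p unfolding mono_connected_def is_path_def
      by (intro exI[of _ "xs @ [w]"]) auto
  next
    case False
    have "w \<in> verts G" using assms(1,3) simple_graph_edgeD(2) unfolding mono_adj_def by metis
    then show ?thesis
      using p assms(3) False \<open>p \<noteq> []\<close> path_edges_snoc[OF \<open>p \<noteq> []\<close>, of w]
      unfolding mono_connected_def is_path_def mono_adj_def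
      by (intro exI[of _ "p @ [w]"]) auto
  qed
qed

lemma mono_connected_if_rtranclp:
  assumes "(mono_adj G \<delta> k)\<^sup>*\<^sup>* u v" "simple_graph G" "u \<in> verts G"
  shows "mono_connected G \<delta> k u v"
  using assms(1)
  by induction (auto intro: mono_connected_refl mono_connected_step assms(2,3))

section \<open>Monochromatic components and how they separate vertices\<close>

lemma mono_component_eq_if_adj:
  assumes "mono_adj G \<delta> k u v"
  shows "mono_component G \<delta> k u = mono_component G \<delta> k v"
proof -
  \<comment> \<open>Edges are unordered, so the step can be put in front of a walk from either
    end.\<close>
  have "mono_adj G \<delta> k v u" using assms unfolding mono_adj_def by (simp add: insert_commute)
  with assms show ?thesis
    unfolding mono_component_def by (auto intro: converse_rtranclp_into_rtranclp)
qed

lemma mono_connected_if_component_eq: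
  assumes "mono_component G \<delta> k u = mono_component G \<delta> k v" "simple_graph G" "u \<in> verts G"
  shows "mono_connected G \<delta> k u v"
proof -
  \<comment> \<open>By reflexivity \<open>v\<close> lies in its own component, which is also that of
    \<open>u\<close>.\<close>
  have "v \<in> mono_component G \<delta> k u" unfolding assms(1) by (simp add: mono_component_def)
  then show ?thesis
    using mono_connected_if_rtranclp assms(2,3) by (simp add: mono_component_def)
qed

text \<open>Sharing both components would give a red path and a blue path from \<open>u\<close> to
  \<open>v\<close>, which is forbidden for distinct vertices.\<close>

lemma cartesian_nac_coloring_components_inj:
  assumes "cartesian_nac_coloring G \<delta>" "simple_graph G" "u \<in> verts G" "v \<in> verts G"
    and "\<And>k. mono_component G \<delta> k u = mono_component G \<delta> k v"
  shows "u = v"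
  using assms mono_connected_if_component_eq unfolding cartesian_nac_coloring_def by metis

text \<open>With two colors, the edge has the color other than \<open>k\<close>, so its ends share
  that component. If they shared the \<open>k\<close>-component as well, they would coincide, and
  the edge would be a loop.\<close>

lemma mono_component_neq_if_edge:
  assumes "cartesian_nac_coloring G \<delta>" "simple_graph G" "{u, v} \<in> edges G" "\<delta> {u, v} \<noteq> k"
  shows "mono_component G \<delta> k u \<noteq> mono_component G \<delta> k v"
proof
  assume eq: "mono_component G \<delta> k u = mono_component G \<delta> k v"
  have "mono_component G \<delta> j u = mono_component G \<delta> j v" for j
  proof (cases "j = k")
    case False
    then have "\<delta> {u, v} = j" using assms(4) by (metis color.exhaust)
    then show ?thesis using assms(3) by (intro mono_component_eq_if_adj) (simp add: mono_adj_def)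
  qed (use eq in simp)
  then show False
    using cartesian_nac_coloring_components_inj simple_graph_edgeD assms(1-3) by metis
qed

section \<open>The quotients, the map into their product, and its image\<close>

lemma simple_graph_mono_quotient:
  assumes "cartesian_nac_coloring G \<delta>" "simple_graph G"
  shows "simple_graph (mono_quotient G \<delta> k)"
  unfolding simple_graph_def
proof
  fix e assume "e \<in> edges (mono_quotient G \<delta> k)"
  then obtain u v where uv: "{u, v} \<in> edges G" "\<delta> {u, v} \<noteq> k"
      "e = {mono_component G \<delta> k u, mono_component G \<delta> k v}"
    by (auto simp: mono_quotient_def)
  moreover have "u \<in> verts G" "v \<in> verts G"
    using simple_graph_edgeD[OF assms(2) uv(1)] by blast+
  moreover have "mono_component G \<delta> k u \<noteq> mono_component G \<delta> k v"
    using mono_component_neq_if_edge[OF assms uv(1,2)] .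
  ultimately show "\<exists>x \<in> verts (mono_quotient G \<delta> k). \<exists>y \<in> verts (mono_quotient G \<delta> k).
      x \<noteq> y \<and> e = {x, y}"
    by (auto simp: mono_quotient_def)
qed

text \<open>This is where surjectivity of the coloring enters: some edge has the color other than
  \<open>k\<close>, and its ends lie in different \<open>k\<close>-components.\<close>

lemma mono_quotient_nontrivial:
  assumes "cartesian_nac_coloring G \<delta>" "simple_graph G"
  shows "\<exists>x \<in> verts (mono_quotient G \<delta> k). \<exists>y \<in> verts (mono_quotient G \<delta> k). x \<noteq> y"
proof -
  obtain j :: color where "j \<noteq> k" by (metis color.distinct(1))
  moreover have "j \<in> \<delta> ` edges G"
    using assms(1) unfolding cartesian_nac_coloring_def nac_coloring_def by blast
  ultimately obtain e where e: "e \<in> edges G" "\<delta> e \<noteq> k" by blast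
  then obtain u v where "u \<in> verts G" "v \<in> verts G" "e = {u, v}"
    using assms(2) simple_graph_edgeE by metis
  moreover from this have "mono_component G \<delta> k u \<noteq> mono_component G \<delta> k v"
    using mono_component_neq_if_edge assms e by metis
  ultimately show ?thesis by (auto simp: mono_quotient_def)
qed

text \<open>A red edge fixes the red component, the first coordinate, and survives in the blue
  quotient, the second factor; a blue edge does the opposite.\<close>

lemma graph_morphism_mono_components:
  assumes "simple_graph G"
  shows "graph_morphism G (mono_quotient G \<delta> Red \<box> mono_quotient G \<delta> Blue)
           (\<lambda>v. (mono_component G \<delta> Red v, mono_component G \<delta> Blue v))"
    (is "graph_morphism G (?Q1 \<box> ?Q2) ?h")
  unfolding graph_morphism_def
proof (intro conjI ballI)
  show "?h ` verts G \<subseteq> verts (?Q1 \<box> ?Q2)"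
    by (auto simp: cartesian_product_def mono_quotient_def)
next
  fix e assume "e \<in> edges G"
  then obtain u v where uv: "u \<in> verts G" "v \<in> verts G" "e = {u, v}"
    using assms simple_graph_edgeE by metis
  have adj: "mono_adj G \<delta> (\<delta> e) u v" using uv \<open>e \<in> edges G\<close> by (simp add: mono_adj_def)
  have "fst (?h u) = fst (?h v) \<and> {snd (?h u), snd (?h v)} \<in> edges ?Q2 \<or>
        snd (?h u) = snd (?h v) \<and> {fst (?h u), fst (?h v)} \<in> edges ?Q1"
  proof (cases "\<delta> e")
    case Red
    then have "{snd (?h u), snd (?h v)} \<in> edges ?Q2"
      using uv \<open>e \<in> edges G\<close> by (force simp: mono_quotient_def)
    then show ?thesis using mono_component_eq_if_adj[OF adj] Red by simp
  next
    case Blue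
    then have "{fst (?h u), fst (?h v)} \<in> edges ?Q1"
      using uv \<open>e \<in> edges G\<close> by (force simp: mono_quotient_def)
    then show ?thesis using mono_component_eq_if_adj[OF adj] Blue by simp
  qed
  moreover have "?h w \<in> verts ?Q1 \<times> verts ?Q2" if "w \<in> verts G" for w
    using that by (simp add: mono_quotient_def)
  ultimately have "{?h u, ?h v} \<in> edges (?Q1 \<box> ?Q2)"
    using uv by (intro cartesian_product_edgeI) auto
  then show "?h ` e \<in> edges (?Q1 \<box> ?Q2)" using uv by simp
qed

text \<open>The subgraph takes only the images of edges of \<open>G\<close>: \<open>H\<close> may
  have further edges between image vertices, so the induced subgraph need not be isomorphic to
  \<open>G\<close>.\<close>

lemma inj_morphism_image_subgraph:
  assumes "simple_graph G" "graph_morphism G H h" "inj_on h (verts G)"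
  shows "\<exists>S. subgraph S H \<and> graph_isomorphism G S h"
proof (intro exI conjI)
  let ?S = "\<lparr>verts = h ` verts G, edges = image h ` edges G\<rparr>"
  have "simple_graph ?S"
    unfolding simple_graph_def
  proof
    fix e assume "e \<in> edges ?S"
    then obtain f where "f \<in> edges G" "e = h ` f" by auto
    then obtain u v where "u \<in> verts G" "v \<in> verts G" "u \<noteq> v" "e = {h u, h v}"
      using simple_graph_edgeE[OF assms(1)] by (metis image_empty image_insert)
    then show "\<exists>x \<in> verts ?S. \<exists>y \<in> verts ?S. x \<noteq> y \<and> e = {x, y}"
      using assms(3) by (auto simp: inj_on_eq_iff)
  qed
  then show "subgraph ?S H"
    using assms(2) unfolding subgraph_def graph_morphism_def by auto
  have "{u, v} \<in> edges G \<longleftrightarrow> {h u, h v} \<in> edges ?S"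
    if uv: "u \<in> verts G" "v \<in> verts G" for u v
  proof
    assume "{h u, h v} \<in> edges ?S"
    then obtain f where f: "f \<in> edges G" "h ` f = h ` {u, v}" by auto
    \<comment> \<open>Since \<open>h\<close> is injective only on \<open>verts G\<close>, equal
      images determine the edge only once both sets are known to lie there.\<close>
    have "f \<subseteq> verts G" using simple_graph_edgeE[OF assms(1) f(1)] by auto
    then have "f = {u, v}"
      using uv f(2) inj_on_image_eq_iff[OF assms(3), of f "{u, v}"] by blast
    then show "{u, v} \<in> edges G" using f(1) by simp
  next
    assume "{u, v} \<in> edges G"
    then have "h ` {u, v} \<in> image h ` edges G" by (rule imageI)
    then show "{h u, h v} \<in> edges ?S" by simp
  qed
  then show "graph_isomorphism G ?S h"
    using assms(3) unfolding graph_isomorphism_def by (simp add: bij_betw_def)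
qed

theorem theorem2p9:
  fixes G :: "'a graph"
  assumes "simple_graph G"
    and "\<exists>\<delta>. cartesian_nac_coloring G \<delta>"
  shows "\<exists>(Q1 :: 'a set graph) (Q2 :: 'a set graph) (h :: 'a \<Rightarrow> 'a set \<times> 'a set).
           simple_graph Q1 \<and> simple_graph Q2 \<and>
           (\<exists>x \<in> verts Q1. \<exists>y \<in> verts Q1. x \<noteq> y) \<and>
           (\<exists>x \<in> verts Q2. \<exists>y \<in> verts Q2. x \<noteq> y) \<and>
           graph_morphism G (Q1 \<box> Q2) h \<and>
           inj_on h (verts G) \<and>
           (\<forall>x \<in> verts Q1. \<exists>p \<in> h ` verts G. fst p = x) \<and>
           (\<forall>y \<in> verts Q2. \<exists>p \<in> h ` verts G. snd p = y) \<and>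
           (\<exists>S. subgraph S (Q1 \<box> Q2) \<and> graph_isomorphism G S h)"
proof -
  obtain \<delta> where \<delta>: "cartesian_nac_coloring G \<delta>" using assms(2) by blast
  let ?h = "\<lambda>v. (mono_component G \<delta> Red v, mono_component G \<delta> Blue v)"
  have inj: "inj_on ?h (verts G)"
  proof (rule inj_onI)
    fix u v assume "u \<in> verts G" "v \<in> verts G" "?h u = ?h v"
    moreover from this have "mono_component G \<delta> k u = mono_component G \<delta> k v" for k
      by (cases k) auto
    ultimately show "u = v"
      using cartesian_nac_coloring_components_inj[OF \<delta> assms(1)] by blast
  qed
  note mor = graph_morphism_mono_components[OF assms(1), of \<delta>]
  show ?thesis
  proof (rule exI[of _ "mono_quotient G \<delta> Red"], rule exI[of _ "mono_quotient G \<delta> Blue"],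
      rule exI[of _ ?h], intro conjI)
    \<comment> \<open>Every vertex of a quotient is the component of some vertex of
      \<open>G\<close>, hence a coordinate of that vertex's image.\<close>
    show "\<forall>x \<in> verts (mono_quotient G \<delta> Red). \<exists>p \<in> ?h ` verts G. fst p = x"
      "\<forall>y \<in> verts (mono_quotient G \<delta> Blue). \<exists>p \<in> ?h ` verts G. snd p = y"
      by (auto simp: mono_quotient_def)
  qed (rule simple_graph_mono_quotient[OF \<delta> assms(1)] mono_quotient_nontrivial[OF \<delta> assms(1)]
      mor inj inj_morphism_image_subgraph[OF assms(1) mor inj])+
qed

end
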